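(* Let $\theta,a,b>0$ and, on a common probability space, let $(v_n)_{n\ge1}$ be i.i.d. $Be(1,\theta)$ random variables and $v$ a $Be(a,b)$ random variable. Let $w_n=v_n\prod_{j=1}^{n-1}(1-v_j)$ and $w_n'=v(1-v)^{n-1}$ for $n\ge 1$. Let $P=\sum_{n\ge1}w_n\delta_{z_n}$ (a Dirichlet process) and $P'=\sum_{n\ge1}w_n'\delta_{z_n}$ (a geometric process with parameters $(a,b,P_0)$) share the same locations $(z_n)_{n\ge1}$. Then, almost surely, $$D_{\mathrm{KL}}(P\|P')=\sum_{n=1}^{\infty}\left[\prod_{j=1}^{n-1}(1-v_j)\right]d(v_n\|v),$$ and, almost surely, $$D_{\mathrm{KL}}(P'\|P)=\sum_{n=1}^{\infty}(1-v)^{n-1}\,d(v\|v_n).$$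
   Context: $Be(a,b)$ is the beta distribution with mean $a/(a+b)$. The locations $(z_n)_{n\ge1}$ are i.i.d. from a non-atomic probability distribution $P_0$ on a Polish space and independent of the weights. Since the locations are shared (and a.s. distinct), the Kullback-Leibler divergences are the random variables $$D_{\mathrm{KL}}(P\|P')=\sum_{n=1}^\infty w_n\log\frac{w_n}{w_n'},\qquad D_{\mathrm{KL}}(P'\|P)=\sum_{n=1}^\infty w_n'\log\frac{w_n'}{w_n}.$$ The binary divergence is, for $x,y\in(0,1)$, $d(x\|y)=x\log\frac{x}{y}+(1-x)\log\frac{1-x}{1-y}$. Empty products equal $1$. *)

theory Defs
  imports "HOL-Probability.Probability"
begin

text \<open>All sequences are indexed from 0: index \<open>n\<close> below stands for the index \<open>n + 1\<close> of the usual
  presentation \<open>(v\<^sub>n)\<close>, \<open>n \<ge> 1\<close>.\<close>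

definition beta_density :: "real \<Rightarrow> real \<Rightarrow> real \<Rightarrow> real" where
  "beta_density a b x =
     (if 0 < x \<and> x < 1 then x powr (a - 1) * (1 - x) powr (b - 1) / Beta a b else 0)"

definition atom_of :: "'a measure \<Rightarrow> 'a set \<Rightarrow> bool" where
  "atom_of M A \<longleftrightarrow> A \<in> sets M \<and> emeasure M A > 0 \<and>
     (\<forall>B \<in> sets M. B \<subseteq> A \<longrightarrow> emeasure M B = 0 \<or> emeasure M B = emeasure M A)"

definition non_atomic :: "'a measure \<Rightarrow> bool" where
  "non_atomic M \<longleftrightarrow> (\<nexists>A. atom_of M A)"

text \<open>The library's \<open>indep_var\<close> forces both random variables to have the same value type; this is the
  same notion (compare \<open>prob_space.indep_var_eq\<close>) without that restriction.\<close>

definition indep_rvs ::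
  "'w measure \<Rightarrow> 'b measure \<Rightarrow> ('w \<Rightarrow> 'b) \<Rightarrow> 'c measure \<Rightarrow> ('w \<Rightarrow> 'c) \<Rightarrow> bool" where
  "indep_rvs M S X T Y \<longleftrightarrow>
     X \<in> measurable M S \<and> Y \<in> measurable M T \<and>
     prob_space.indep_set M
       (sigma_sets (space M) {X -` A \<inter> space M | A. A \<in> sets S})
       (sigma_sets (space M) {Y -` A \<inter> space M | A. A \<in> sets T})"

definition stick_weight :: "(nat \<Rightarrow> real) \<Rightarrow> nat \<Rightarrow> real" where
  "stick_weight v n = v n * (\<Prod>j<n. 1 - v j)"

definition geom_weight :: "real \<Rightarrow> nat \<Rightarrow> real" where
  "geom_weight v n = v * (1 - v) ^ n"

definition discrete_measure :: "(nat \<Rightarrow> real) \<Rightarrow> (nat \<Rightarrow> 'a::topological_space) \<Rightarrow> 'a measure" where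
  "discrete_measure w z =
     measure_of UNIV (sets borel) (\<lambda>A. \<Sum>n. ennreal (w n) * emeasure (return borel (z n)) A)"

lemma sets_discrete_measure [simp, measurable_cong]:
  "sets (discrete_measure w z) = sets borel"
  unfolding discrete_measure_def
  by (metis sets.sets_measure_of_eq space_borel)

lemma space_discrete_measure [simp]: "space (discrete_measure w z) = UNIV"
  using sets_eq_imp_space_eq[OF sets_discrete_measure] by simp

lemma emeasure_discrete_measure:
  assumes "A \<in> sets borel"
  shows "emeasure (discrete_measure w z) A = (\<Sum>n. ennreal (w n) * indicator A (z n))"
proof -
  let ?\<mu> = "\<lambda>A. \<Sum>n. ennreal (w n) * emeasure (return borel (z n)) A"
  have "countably_additive (sets borel) ?\<mu>"
  proof (rule countably_additiveI)
    fix B :: "nat \<Rightarrow> 'a set"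
    assume B: "range B \<subseteq> sets borel" "disjoint_family B"
    have "(\<Sum>i. ?\<mu> (B i)) = (\<Sum>n. \<Sum>i. ennreal (w n) * emeasure (return borel (z n)) (B i))"
      by (subst (1 2) nn_integral_count_space_nat[symmetric])
        (simp add: nn_integral_suminf[symmetric])
    also have "\<dots> = ?\<mu> (\<Union>i. B i)"
    proof -
      have "(\<Sum>i. emeasure (return borel (z n)) (B i)) = emeasure (return borel (z n)) (\<Union>i. B i)" for n
        by (intro suminf_emeasure) (use B in auto)
      then show ?thesis
        by (simp only: ennreal_suminf_cmult)
    qed
    finally show "(\<Sum>i. ?\<mu> (B i)) = ?\<mu> (\<Union>i. B i)" .
  qed
  then have "emeasure (discrete_measure w z) A = ?\<mu> A"
    using assms sets_discrete_measure[of w z] unfolding discrete_measure_def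
    by (intro emeasure_measure_of_sigma)
      (auto simp: positive_def intro: sets.sigma_algebra_axioms[of borel, simplified])
  then show ?thesis
    using assms by simp
qed

text \<open>Divergence of \<open>P\<close> from \<open>Q\<close> with values in the extended reals. The library's
  \<open>KL_divergence b Q P\<close> takes the reference measure \<open>Q\<close> first, and it is a Bochner integral, so
  that it is meaningful only if \<open>P\<close> is absolutely continuous with respect to \<open>Q\<close> and the log-density
  is \<open>P\<close>-integrable. The negative part of the log-density always has finite integral for probability
  measures, hence non-integrability means that the divergence is infinite.\<close>

definition D_KL :: "'a measure \<Rightarrow> 'a measure \<Rightarrow> ereal" where
  "D_KL P Q =
     (if absolutely_continuous Q P \<and> integrable P (entropy_density (exp 1) Q P)
      then ereal (KL_divergence (exp 1) Q P) else \<infinity>)"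

text \<open>Intended for arguments in \<open>(0, 1)\<close>.\<close>

definition binary_div :: "real \<Rightarrow> real \<Rightarrow> real" where
  "binary_div x y = x * ln (x / y) + (1 - x) * ln ((1 - x) / (1 - y))"

end

theory Submission
  imports Defs
begin

text \<open>
  Both identities are instances of one deterministic fact. Almost surely the locations are distinct,
  because a non-atomic distribution on a Polish space gives no mass to points, all sticks lie in
  \<open>(0, 1)\<close>, and the products \<open>S\<^sub>N = \<Prod>j<N. 1 - v\<^sub>j\<close> and \<open>S'\<^sub>N = (1 - v)^N\<close>
  tend to 0. On this event the weights are positive and sum to 1, the density of one measure with
  respect to the other at an atom is the ratio of the weights there, and the divergence is the
  relative entropy series of the weights (\<open>D_KL_discrete_measure\<close>). The sum always exists:
  since \<open>p ln (p/q) \<ge> p - q\<close>, the series either converges absolutely or has the sum \<open>\<infinity>\<close>.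

  The geometric weights are the stick-breaking weights of a constant sequence, so that it suffices to
  treat two arbitrary sequences of sticks \<open>x\<close> and \<open>y\<close>, and to exchange them for the second identity.
  Splitting the unit interval into the first \<open>N\<close> pieces and the rest, one piece at a time, the chain
  rule for relative entropy gives
  \<open>\<Sum>n<N. S\<^sub>n d(x\<^sub>n\<parallel>y\<^sub>n) = (\<Sum>n<N. w\<^sub>n ln (w\<^sub>n/w'\<^sub>n)) + S\<^sub>N ln (S\<^sub>N/S'\<^sub>N)\<close>.
  The last term is at least \<open>S\<^sub>N - S'\<^sub>N\<close>, which tends to 0; so if the series of the weights diverges,
  then the other one does. If it converges, the log-sum inequality bounds the last term above by the
  tail of the series from \<open>N\<close> on, which tends to 0 as well, and the two sums agree
  (\<open>stick_breaking_series_same_sum\<close>).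

  That \<open>S\<^sub>N\<close> tends to 0 holds since its expectation is \<open>c^N\<close>, with \<open>c < 1\<close> the expectation of
  \<open>1 - v\<^sub>0\<close>: the sum of all \<open>S\<^sub>N\<close> has a finite expectation, hence is almost surely finite.
\<close>

section \<open>Relative entropy series\<close>

lemma ln_ratio_lower_bound:
  fixes p q :: real
  assumes "p > 0" "q > 0"
  shows "p - q \<le> p * ln (p / q)"
proof -
  have "ln (q / p) \<le> q / p - 1"
    using assms by (intro ln_le_minus_one) simp
  then have "p * ln (q / p) \<le> p * (q / p - 1)"
    using assms by (intro mult_left_mono) auto
  also have "\<dots> = q - p"
    using assms by (simp add: field_simps)
  finally show ?thesis
    using assms by (simp add: ln_div right_diff_distrib)
qed

text \<open>With \<open>r = a / b\<close> the sequences \<open>p\<close> and \<open>r q\<close> have the same sum, so the termwise bound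
  \<open>ln_ratio_lower_bound\<close> for this pair has a right-hand side that sums to 0. Splitting off the
  constant \<open>ln r\<close> from each logarithm turns this into the claim.\<close>

lemma log_sum_inequality:
  fixes p q :: "nat \<Rightarrow> real"
  assumes p: "\<And>n. p n > 0" and q: "\<And>n. q n > 0"
    and "p sums a" "q sums b"
    and "summable (\<lambda>n. p n * ln (p n / q n))"
  shows "a * ln (a / b) \<le> (\<Sum>n. p n * ln (p n / q n))"
proof -
  have "a > 0" "b > 0"
    using suminf_pos[of p] suminf_pos[of q] assms by (auto simp: sums_iff)
  define r where "r = a / b"
  have "r > 0" using \<open>a > 0\<close> \<open>b > 0\<close> by (simp add: r_def)
  have "p n * ln r + p n - r * q n \<le> p n * ln (p n / q n)" for n
    using ln_ratio_lower_bound[OF p[of n] mult_pos_pos[OF \<open>r > 0\<close> q[of n]]] \<open>r > 0\<close> p[of n] q[of n]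
    by (simp add: ln_div ln_mult algebra_simps)
  moreover have "(\<lambda>n. p n * ln r + p n - r * q n) sums (a * ln r + a - r * b)"
    by (intro sums_add sums_diff sums_mult sums_mult2 assms)
  ultimately have "a * ln r + a - r * b \<le> (\<Sum>n. p n * ln (p n / q n))"
    using assms by (metis (no_types, lifting) sums_le summable_sums)
  then show ?thesis
    using \<open>b > 0\<close> by (simp add: r_def)
qed

text \<open>A relative entropy series that is not absolutely convergent can only diverge to \<open>\<infinity>\<close>: its terms
  are bounded below by the summable \<open>p n - q n\<close>, so that after subtracting the latter one is left with
  a series of nonnegative terms.\<close>

lemma relative_entropy_series_sums_PInf:
  fixes p q :: "nat \<Rightarrow> real"
  assumes p: "\<And>n. p n > 0" and q: "\<And>n. q n > 0"
    and sums: "p sums a" "q sums b"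
  defines "t \<equiv> \<lambda>n. p n * ln (p n / q n)"
  assumes not_summable: "\<not> summable (\<lambda>n. \<bar>t n\<bar>)"
  shows "(\<lambda>n. ereal (t n)) sums \<infinity>"
proof -
  define u where "u n = t n - (p n - q n)" for n
  have u: "u n \<ge> 0" for n
    using ln_ratio_lower_bound[OF p q, of n n] by (simp add: u_def t_def)
  have pq: "summable (\<lambda>n. \<bar>p n - q n\<bar>)"
  proof (rule summable_comparison_test_ev)
    show "summable (\<lambda>n. p n + q n)"
      using sums by (intro summable_add) (auto simp: sums_iff)
    show "\<forall>\<^sub>F n in sequentially. norm \<bar>p n - q n\<bar> \<le> p n + q n"
      using p q by (intro always_eventually allI) (smt (verit) real_norm_def)
  qed
  have "\<not> summable u"
  proof
    assume "summable u"
    then have "summable (\<lambda>n. u n + \<bar>p n - q n\<bar>)"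
      using pq by (rule summable_add)
    then have "summable (\<lambda>n. \<bar>t n\<bar>)"
      by (rule summable_comparison_test_ev[rotated])
        (use u in \<open>auto intro!: always_eventually simp: u_def; smt (verit)\<close>)
    with not_summable show False ..
  qed
  have "filterlim (\<lambda>N. \<Sum>n<N. u n) at_top sequentially"
    unfolding filterlim_at_top eventually_sequentially
  proof
    fix Z
    have "\<exists>N. Z \<le> (\<Sum>n<N. u n)"
      using \<open>\<not> summable u\<close> summableI_nonneg_bounded[of u Z] u by (metis linear)
    then obtain N where "Z \<le> (\<Sum>n<N. u n)" ..
    moreover have "(\<Sum>n<N. u n) \<le> (\<Sum>n<m. u n)" if "m \<ge> N" for m
      using u that by (intro sum_mono2) auto
    ultimately show "\<exists>N. \<forall>m\<ge>N. Z \<le> (\<Sum>n<m. u n)"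
      by (meson order_trans)
  qed
  moreover have "(\<lambda>N. \<Sum>n<N. p n - q n) \<longlonglongrightarrow> a - b"
    using sums_diff[OF sums] by (simp add: sums_def)
  ultimately have "filterlim (\<lambda>N. (\<Sum>n<N. p n - q n) + (\<Sum>n<N. u n)) at_top sequentially"
    by (intro filterlim_tendsto_add_at_top)
  then have "filterlim (\<lambda>N. \<Sum>n<N. t n) at_top sequentially"
    by (simp add: u_def sum.distrib[symmetric])
  then show ?thesis
    by (simp add: sums_def tendsto_PInfty_eq_at_top)
qed

section \<open>Divergence of discrete measures with common distinct atoms\<close>

text \<open>As the image of a weighted counting measure, a discrete measure inherits its integrals from
  series over the natural numbers.\<close>

lemma discrete_measure_eq_distr:
  "discrete_measure p z = distr (density (count_space UNIV) (\<lambda>n. ennreal (p n))) borel z"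
proof (rule measure_eqI)
  fix A assume "A \<in> sets (discrete_measure p z)"
  then show "emeasure (discrete_measure p z) A =
      emeasure (distr (density (count_space UNIV) (\<lambda>n. ennreal (p n))) borel z) A"
    by (simp add: emeasure_discrete_measure emeasure_distr emeasure_density
        nn_integral_count_space_nat indicator_vimage)
qed simp

lemma AE_discrete_measure_iff:
  assumes "\<And>n. p n > 0" "{x. R x} \<in> sets borel"
  shows "(AE x in discrete_measure p z. R x) \<longleftrightarrow> (\<forall>n. R (z n))"
  unfolding discrete_measure_eq_distr
  using assms by (subst AE_distr_iff) (auto simp: AE_density AE_count_space)

lemma
  fixes f :: "'a::topological_space \<Rightarrow> real"
  assumes "\<And>n. p n > 0" "f \<in> borel_measurable borel"
  shows integrable_discrete_measure_iff:
      "integrable (discrete_measure p z) f \<longleftrightarrow> summable (\<lambda>n. \<bar>p n * f (z n)\<bar>)"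
    and integral_discrete_measure:
      "summable (\<lambda>n. \<bar>p n * f (z n)\<bar>) \<Longrightarrow>
        integral\<^sup>L (discrete_measure p z) f = (\<Sum>n. p n * f (z n))"
proof -
  have [measurable]: "f \<in> borel_measurable borel" by fact
  have nonneg: "p n \<ge> 0" for n
    using assms(1)[of n] by simp
  have "integrable (discrete_measure p z) f \<longleftrightarrow>
      integrable (density (count_space UNIV) (\<lambda>n. ennreal (p n))) (\<lambda>n. f (z n))"
    unfolding discrete_measure_eq_distr by (rule integrable_distr_eq) simp_all
  also have "\<dots> \<longleftrightarrow> integrable (count_space UNIV) (\<lambda>n. p n * f (z n))"
    using nonneg by (subst integrable_density) simp_all
  finally have int: "integrable (discrete_measure p z) f \<longleftrightarrow>
      integrable (count_space UNIV) (\<lambda>n. p n * f (z n))" .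
  then show iff: "integrable (discrete_measure p z) f \<longleftrightarrow> summable (\<lambda>n. \<bar>p n * f (z n)\<bar>)"
    by (simp only: integrable_count_space_nat_iff real_norm_def)
  assume "summable (\<lambda>n. \<bar>p n * f (z n)\<bar>)"
  with int iff have "integrable (count_space UNIV) (\<lambda>n. p n * f (z n))"
    by simp
  then have "(\<Sum>n. p n * f (z n)) = (\<integral>n. p n * f (z n) \<partial>count_space UNIV)"
    by (simp add: integral_count_space_nat)
  also have "\<dots> = integral\<^sup>L (density (count_space UNIV) (\<lambda>n. ennreal (p n))) (\<lambda>n. f (z n))"
    using nonneg by (subst integral_density) simp_all
  also have "\<dots> = integral\<^sup>L (discrete_measure p z) f"
    unfolding discrete_measure_eq_distr by (rule integral_distr[symmetric]) simp_all
  finally show "integral\<^sup>L (discrete_measure p z) f = (\<Sum>n. p n * f (z n))" ..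
qed

lemma prob_space_discrete_measure:
  assumes "\<And>n. p n > 0" "p sums 1"
  shows "prob_space (discrete_measure p z)"
proof
  have "(\<Sum>n. ennreal (p n)) = ennreal 1"
    using assms by (intro suminf_ennreal_eq) (auto simp: less_imp_le)
  then show "emeasure (discrete_measure p z) (space (discrete_measure p z)) = 1"
    by (simp add: emeasure_discrete_measure)
qed

text \<open>Distinctness of the atoms makes the ratio of the weights a function of the location.\<close>

lemma density_discrete_measure:
  fixes z :: "nat \<Rightarrow> 'a::t1_space"
  assumes p: "\<And>n. p n > 0" and q: "\<And>n. q n > 0" and "inj z"
  obtains f where "f \<in> borel_measurable borel" "\<And>n. f (z n) = ennreal (p n / q n)"
    "density (discrete_measure q z) f = discrete_measure p z"
proof
  define f where "f x = (\<Sum>n. ennreal (p n / q n) * indicator {z n} x)" for x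
  show f[measurable]: "f \<in> borel_measurable borel"
    unfolding f_def by measurable
  show fz: "f (z n) = ennreal (p n / q n)" for n
    unfolding f_def
    by (rule suminf_cmult_indicator) (use \<open>inj z\<close> in \<open>auto simp: disjoint_family_on_def inj_eq\<close>)
  show "density (discrete_measure q z) f = discrete_measure p z"
  proof (rule measure_eqI)
    fix A assume "A \<in> sets (density (discrete_measure q z) f)"
    then have [measurable]: "A \<in> sets borel" by simp
    have "ennreal (q n) * (f (z n) * indicator A (z n)) = ennreal (p n) * indicator A (z n)" for n
      using p[of n] q[of n]
      by (simp add: fz mult.assoc[symmetric] ennreal_mult[symmetric])
    then show "emeasure (density (discrete_measure q z) f) A = emeasure (discrete_measure p z) A"
      by (simp add: emeasure_density emeasure_discrete_measure)
        (simp add: discrete_measure_eq_distr nn_integral_distr nn_integral_density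
          nn_integral_count_space_nat)
  qed simp
qed

text \<open>The Radon-Nikodym derivative is determined only up to null sets, but each atom has positive mass,
  so that its value there is forced. Both branches in the definition of the divergence agree with
  the sum of the series, by \<open>relative_entropy_series_sums_PInf\<close> for the infinite one.\<close>

theorem D_KL_discrete_measure:
  fixes z :: "nat \<Rightarrow> 'a::t1_space"
  assumes p: "\<And>n. p n > 0" "p sums 1" and q: "\<And>n. q n > 0" "q sums 1" and "inj z"
  shows "(\<lambda>n. ereal (p n * ln (p n / q n))) sums
    D_KL (discrete_measure p z) (discrete_measure q z)"
proof -
  let ?P = "discrete_measure p z" and ?Q = "discrete_measure q z"
  let ?t = "\<lambda>n. p n * ln (p n / q n)"
  interpret Q: prob_space ?Q using q by (rule prob_space_discrete_measure)
  obtain f where f[measurable]: "f \<in> borel_measurable borel"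
    and fz: "\<And>n. f (z n) = ennreal (p n / q n)" and dens: "density ?Q f = ?P"
    by (rule density_discrete_measure[of p q z, OF p(1) q(1) \<open>inj z\<close>]) (rule that)
  have "AE x in ?Q. f x = RN_deriv ?Q ?P x"
    using f dens by (intro Q.RN_deriv_unique) simp_all
  moreover have "{x. f x = RN_deriv ?Q ?P x} \<in> sets borel"
    using borel_measurable_eq[of f borel "RN_deriv ?Q ?P"] f borel_measurable_RN_deriv[of ?Q ?P]
    by simp
  ultimately have RN: "RN_deriv ?Q ?P (z n) = ennreal (p n / q n)" for n
    using q(1) fz by (simp add: AE_discrete_measure_iff)
  have ed: "entropy_density (exp 1) ?Q ?P (z n) = ln (p n / q n)" for n
    using p(1)[of n] q(1)[of n] by (simp add: entropy_density_def RN log_def)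
  have [measurable]: "entropy_density (exp 1) ?Q ?P \<in> borel_measurable borel"
    using measurable_entropy_density[of "exp 1" ?Q ?P] by simp
  have ac: "absolutely_continuous ?Q ?P"
    unfolding dens[symmetric] by (rule absolutely_continuousI_density) simp
  have int: "integrable ?P (entropy_density (exp 1) ?Q ?P) \<longleftrightarrow> summable (\<lambda>n. \<bar>?t n\<bar>)"
    using p(1) by (simp add: integrable_discrete_measure_iff ed)
  show ?thesis
  proof (cases "summable (\<lambda>n. \<bar>?t n\<bar>)")
    case True
    then have "D_KL ?P ?Q = ereal (\<Sum>n. ?t n)"
      using p(1) ac int by (simp add: D_KL_def KL_divergence_def integral_discrete_measure ed)
    then show ?thesis
      using summable_rabs_cancel[OF True] by (simp add: sums_ereal summable_sums)
  next
    case False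
    then show ?thesis
      using relative_entropy_series_sums_PInf[of p q, OF p(1) q(1) p(2) q(2)] int
      by (simp add: D_KL_def)
  qed
qed

section \<open>The chain rule along stick breaking\<close>

lemma stick_weight_partial_sum:
  "(\<Sum>n<N. stick_weight x n) = 1 - (\<Prod>j<N. 1 - x j)"
  by (induction N) (simp_all add: stick_weight_def algebra_simps)

lemma stick_weight_sums_1:
  assumes "(\<lambda>N. \<Prod>j<N. 1 - x j) \<longlonglongrightarrow> 0"
  shows "stick_weight x sums 1"
  using tendsto_diff[OF tendsto_const[of 1] assms] by (simp add: sums_def stick_weight_partial_sum)

lemma stick_weight_const: "stick_weight (\<lambda>_. c) n = geom_weight c n"
  by (simp add: stick_weight_def geom_weight_def)

text \<open>In step \<open>N\<close> the piece of length \<open>S x N\<close> that is left splits in the proportions \<open>x N\<close> and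
  \<open>1 - x N\<close>. The logarithms of both new ratios contain \<open>ln (S x N / S y N)\<close>, and what remains of
  them is the binary divergence, scaled by \<open>S x N\<close>; the sums telescope.\<close>

lemma stick_breaking_chain_rule:
  fixes x y :: "nat \<Rightarrow> real"
  assumes x: "\<And>n. 0 < x n" "\<And>n. x n < 1" and y: "\<And>n. 0 < y n" "\<And>n. y n < 1"
  defines "S \<equiv> \<lambda>u N. \<Prod>j<N. 1 - u j"
  shows "(\<Sum>n<N. S x n * binary_div (x n) (y n)) =
    (\<Sum>n<N. stick_weight x n * ln (stick_weight x n / stick_weight y n)) +
      S x N * ln (S x N / S y N)"
proof (induction N)
  case (Suc N)
  have Suc_S: "S u (Suc N) = (1 - u N) * S u N" for u
    by (simp add: S_def)
  have weight: "stick_weight u N = u N * S u N" for u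
    by (simp add: stick_weight_def S_def)
  have pos: "S x N > 0" "S y N > 0"
    using x y by (auto simp: S_def intro!: prod_pos)
  have split: "ln (c * S x N / (d * S y N)) = ln (c / d) + ln (S x N / S y N)" if "c > 0" "d > 0" for c d
    using pos that by (simp add: ln_mult ln_div)
  have "S x N * binary_div (x N) (y N) =
    stick_weight x N * ln (stick_weight x N / stick_weight y N) +
      S x (Suc N) * ln (S x (Suc N) / S y (Suc N)) - S x N * ln (S x N / S y N)"
    unfolding weight Suc_S using split[of "x N" "y N"] split[of "1 - x N" "1 - y N"] x[of N] y[of N]
    by (simp add: binary_div_def) (simp add: algebra_simps)
  with Suc show ?case by simp
qed (simp add: S_def)

text \<open>The remainder of the chain rule is the relative entropy term of the two tails, seen as single
  blocks: the sum of the weights from \<open>N\<close> on is \<open>S x N\<close>. The log-sum inequality says that merging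
  the tail into one block does not increase relative entropy, and this is the upper bound for the
  remainder that forces it to 0 when the sum is finite.\<close>

lemma stick_breaking_series_same_sum:
  fixes x y :: "nat \<Rightarrow> real"
  assumes x: "\<And>n. 0 < x n" "\<And>n. x n < 1" and y: "\<And>n. 0 < y n" "\<And>n. y n < 1"
    and Sx: "(\<lambda>N. \<Prod>j<N. 1 - x j) \<longlonglongrightarrow> 0" and Sy: "(\<lambda>N. \<Prod>j<N. 1 - y j) \<longlonglongrightarrow> 0"
    and KL: "(\<lambda>n. ereal (stick_weight x n * ln (stick_weight x n / stick_weight y n))) sums K"
    and "K \<noteq> - \<infinity>"
  shows "(\<lambda>n. ereal ((\<Prod>j<n. 1 - x j) * binary_div (x n) (y n))) sums K"
proof -
  define S where "S u N = (\<Prod>j<N. 1 - u j)" for u :: "nat \<Rightarrow> real" and N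
  define t where "t n = stick_weight x n * ln (stick_weight x n / stick_weight y n)" for n
  define R where "R N = S x N * ln (S x N / S y N)" for N
  have Spos: "S x N > 0" "S y N > 0" for N
    using x y by (auto simp: S_def intro!: prod_pos)
  have wpos: "stick_weight x n > 0" "stick_weight y n > 0" for n
    using x y by (auto simp: stick_weight_def intro!: mult_pos_pos prod_pos)
  have chain: "(\<Sum>n<N. S x n * binary_div (x n) (y n)) = (\<Sum>n<N. t n) + R N" for N
    using stick_breaking_chain_rule[of x y N, OF x y] by (simp add: S_def t_def R_def)
  have lower: "S x N - S y N \<le> R N" for N
    unfolding R_def by (rule ln_ratio_lower_bound) (fact Spos)+
  have diff0: "(\<lambda>N. S x N - S y N) \<longlonglongrightarrow> 0"
    using tendsto_diff[OF Sx Sy] by (simp add: S_def)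
  have "(\<lambda>N. ereal ((\<Sum>n<N. t n) + R N)) \<longlonglongrightarrow> K"
  proof (cases K)
    case (real k)
    then have t: "t sums k"
      using KL by (simp add: t_def[abs_def] sums_ereal)
    have tail: "(\<lambda>n. stick_weight u (n + N)) sums S u N" if "(\<lambda>N. S u N) \<longlonglongrightarrow> 0" for u N
      using sums_split_initial_segment[OF stick_weight_sums_1[of u], of N] that
      by (simp add: S_def stick_weight_partial_sum)
    have upper: "R N \<le> k - (\<Sum>n<N. t n)" for N
    proof -
      have "R N \<le> (\<Sum>n. t (n + N))"
        unfolding R_def t_def
      proof (rule log_sum_inequality)
        show "(\<lambda>n. stick_weight x (n + N)) sums S x N" "(\<lambda>n. stick_weight y (n + N)) sums S y N"
          using Sx Sy by (intro tail; simp add: S_def)+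
        show "summable (\<lambda>n. stick_weight x (n + N) *
            ln (stick_weight x (n + N) / stick_weight y (n + N)))"
          using summable_ignore_initial_segment[OF sums_summable[OF t], of N] by (simp add: t_def)
      qed (fact wpos)+
      then show ?thesis
        using sums_split_initial_segment[OF t, of N] by (simp add: sums_iff)
    qed
    have tN: "(\<lambda>N. \<Sum>n<N. t n) \<longlonglongrightarrow> k"
      using t by (simp add: sums_def)
    have "R \<longlonglongrightarrow> 0"
    proof (rule tendsto_sandwich[OF _ _ diff0])
      show "(\<lambda>N. k - (\<Sum>n<N. t n)) \<longlonglongrightarrow> 0"
        using tendsto_diff[OF tendsto_const[of k] tN] by simp
    qed (use lower upper in auto)
    with tN have "(\<lambda>N. (\<Sum>n<N. t n) + R N) \<longlonglongrightarrow> k + 0"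
      by (rule tendsto_add)
    then show ?thesis
      using real by simp
  next
    case PInf
    then have "filterlim (\<lambda>N. \<Sum>n<N. t n) at_top sequentially"
      using KL by (simp add: sums_def t_def tendsto_PInfty_eq_at_top)
    then have "filterlim (\<lambda>N. (S x N - S y N) + (\<Sum>n<N. t n)) at_top sequentially"
      by (rule filterlim_tendsto_add_at_top[OF diff0])
    then have "filterlim (\<lambda>N. (\<Sum>n<N. t n) + R N) at_top sequentially"
      by (rule filterlim_at_top_mono) (use lower in \<open>auto intro!: always_eventually simp: algebra_simps\<close>)
    then show ?thesis
      using PInf by (simp add: tendsto_PInfty_eq_at_top)
  qed (use \<open>K \<noteq> -\<infinity>\<close> in simp)
  then show ?thesis
    by (simp add: sums_def chain[symmetric] S_def)
qed

lemma D_KL_stick_breaking: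
  fixes x y :: "nat \<Rightarrow> real" and z :: "nat \<Rightarrow> 'a::t1_space"
  assumes x: "\<And>n. 0 < x n" "\<And>n. x n < 1" and y: "\<And>n. 0 < y n" "\<And>n. y n < 1"
    and Sx: "(\<lambda>N. \<Prod>j<N. 1 - x j) \<longlonglongrightarrow> 0" and Sy: "(\<lambda>N. \<Prod>j<N. 1 - y j) \<longlonglongrightarrow> 0"
    and "inj z"
  defines "K \<equiv> D_KL (discrete_measure (stick_weight x) z) (discrete_measure (stick_weight y) z)"
  shows "(\<lambda>n. ereal (stick_weight x n * ln (stick_weight x n / stick_weight y n))) sums K"
    and "(\<lambda>n. ereal ((\<Prod>j<n. 1 - x j) * binary_div (x n) (y n))) sums K"
proof -
  have wpos: "stick_weight x n > 0" "stick_weight y n > 0" for n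
    using x y by (auto simp: stick_weight_def intro!: mult_pos_pos prod_pos)
  show KL: "(\<lambda>n. ereal (stick_weight x n * ln (stick_weight x n / stick_weight y n))) sums K"
    unfolding K_def
    using wpos Sx Sy \<open>inj z\<close> by (intro D_KL_discrete_measure stick_weight_sums_1)
  have "K \<noteq> - \<infinity>"
    by (simp add: K_def D_KL_def)
  with x y Sx Sy KL show "(\<lambda>n. ereal ((\<Prod>j<n. 1 - x j) * binary_div (x n) (y n))) sums K"
    by (rule stick_breaking_series_same_sum)
qed

section \<open>Almost sure properties of locations and sticks\<close>

lemma non_atomic_singleton_null:
  assumes "non_atomic M" "{x} \<in> sets M"
  shows "emeasure M {x} = 0"
proof (rule ccontr)
  assume "emeasure M {x} \<noteq> 0"
  then have "atom_of M {x}"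
    using assms by (auto simp: atom_of_def subset_singleton_iff zero_less_iff_neq_zero)
  then show False
    using assms by (simp add: non_atomic_def)
qed

lemma (in prob_space) indep_vars_pair:
  assumes indep: "indep_vars M' X I" and ij: "i \<in> I" "j \<in> I" "i \<noteq> j"
  shows "indep_var (M' i) (X i) (M' j) (X j)"
proof -
  have "indep_var
      (M' i) ((\<lambda>f. f i) \<circ> (\<lambda>\<omega>. restrict (\<lambda>k. X k \<omega>) {i}))
      (M' j) ((\<lambda>f. f j) \<circ> (\<lambda>\<omega>. restrict (\<lambda>k. X k \<omega>) {j}))"
    using ij by (intro indep_var_compose[OF indep_var_restrict[OF indep]]) auto
  then show ?thesis
    by (simp add: comp_def)
qed

text \<open>Two locations of different index jointly have the product distribution, and the diagonal is a null set for it since all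
  its sections are single points. In a Polish space the diagonal belongs to the product
  \<open>\<sigma>\<close>-algebra, by second countability.\<close>

lemma (in prob_space) AE_inj_non_atomic:
  fixes z :: "nat \<Rightarrow> 'a \<Rightarrow> 'b::polish_space"
  assumes indep: "indep_vars (\<lambda>_. borel) z UNIV"
    and distr: "\<And>n. distr M borel (z n) = P0"
    and "non_atomic P0"
  shows "AE \<omega> in M. inj (\<lambda>n. z n \<omega>)"
proof -
  have [measurable]: "z n \<in> borel_measurable M" for n
    using indep by (simp add: indep_vars_def)
  have [simp]: "sets P0 = sets borel" "space P0 = UNIV"
    using distr[of 0] by auto
  interpret P0: prob_space P0
    using prob_space_distr[of "z 0" borel] distr by simp
  have "AE \<omega> in M. z i \<omega> \<noteq> z j \<omega>" if "i \<noteq> j" for i j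
  proof -
    define D where "D = {p :: 'b \<times> 'b. fst p = snd p}"
    have D[measurable]: "D \<in> sets (borel \<Otimes>\<^sub>M borel)"
      unfolding D_def borel_prod by (intro borel_closed closed_Collect_eq continuous_intros)
    have "emeasure M {\<omega> \<in> space M. z i \<omega> = z j \<omega>} =
        emeasure (distr M (borel \<Otimes>\<^sub>M borel) (\<lambda>\<omega>. (z i \<omega>, z j \<omega>))) D"
    proof -
      have "(\<lambda>\<omega>. (z i \<omega>, z j \<omega>)) -` D \<inter> space M = {\<omega> \<in> space M. z i \<omega> = z j \<omega>}"
        by (auto simp: D_def)
      then show ?thesis
        by (simp add: emeasure_distr)
    qed
    also have "\<dots> = emeasure (P0 \<Otimes>\<^sub>M P0) D"
      using indep_vars_pair[OF indep, of i j] that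
      by (simp add: indep_var_distribution_eq distr)
    also have "\<dots> = (\<integral>\<^sup>+ x. emeasure P0 {x} \<partial>P0)"
    proof -
      have "D \<in> sets (P0 \<Otimes>\<^sub>M P0)"
        using D by (simp cong: sets_pair_measure_cong)
      moreover have "Pair x -` D = {x}" for x
        by (auto simp: D_def)
      ultimately show ?thesis
        by (simp add: P0.emeasure_pair_measure_alt)
    qed
    also have "\<dots> = 0"
      using \<open>non_atomic P0\<close> by (simp add: non_atomic_singleton_null)
    finally show ?thesis
      by (subst AE_iff_measurable[OF _ refl]) simp_all
  qed
  then have "AE \<omega> in M. \<forall>i j. i \<noteq> j \<longrightarrow> z i \<omega> \<noteq> z j \<omega>"
    by (simp add: AE_all_countable)
  then show ?thesis
    by (auto simp: inj_def)
qed

lemma (in prob_space) beta_AE_in_unit_interval: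
  assumes "distributed M lborel X (beta_density a b)"
  shows "AE \<omega> in M. 0 < X \<omega> \<and> X \<omega> < 1"
proof -
  have "(AE \<omega> in M. 0 < X \<omega> \<and> X \<omega> < 1) \<longleftrightarrow>
      (AE x in lborel. 0 < ennreal (beta_density a b x) \<longrightarrow> 0 < x \<and> x < 1)"
    using assms by (rule distributed_AE2) measurable
  then show ?thesis
    by (auto simp: beta_density_def)
qed

text \<open>Summing the expectations \<open>c ^ N\<close> of the products gives a convergent geometric series, so the
  products are almost surely summable and therefore tend to 0.\<close>

lemma (in prob_space) AE_prod_one_minus_tendsto_0:
  fixes X :: "nat \<Rightarrow> 'a \<Rightarrow> real"
  assumes indep: "indep_vars (\<lambda>_. borel) X UNIV"
    and identical: "\<And>n. distr M borel (X n) = D"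
    and unit: "\<And>n. AE \<omega> in M. 0 < X n \<omega> \<and> X n \<omega> < 1"
  shows "AE \<omega> in M. (\<lambda>N. \<Prod>j<N. 1 - X j \<omega>) \<longlonglongrightarrow> 0"
proof -
  have [measurable]: "X n \<in> borel_measurable M" for n
    using indep by (simp add: indep_vars_def)
  define Y where "Y n \<omega> = ennreal (1 - X n \<omega>)" for n \<omega>
  define c where "c = (\<integral>\<^sup>+ x. ennreal (1 - x) \<partial>D)"
  have Ymeas[measurable]: "Y n \<in> borel_measurable M" for n
    unfolding Y_def by measurable
  have EY: "(\<integral>\<^sup>+ \<omega>. Y n \<omega> \<partial>M) = c" for n
    unfolding c_def identical[of n, symmetric] by (simp add: Y_def nn_integral_distr)
  have Y_less: "AE \<omega> in M. Y n \<omega> < 1" for n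
    using unit[of n] by eventually_elim (simp add: Y_def)
  have "c < 1"
  proof -
    have "c \<le> (\<integral>\<^sup>+ \<omega>. 1 \<partial>M)"
      unfolding EY[of 0, symmetric]
      using Y_less[of 0] by (intro nn_integral_mono_AE) (auto intro: less_imp_le)
    then have "c \<le> 1" by (simp add: emeasure_space_1)
    \<comment> \<open>If \<open>c = 1\<close>, the almost surely positive variable \<open>1 - Y 0\<close> would have expectation 0.\<close>
    moreover have "c \<noteq> 1"
    proof
      assume "c = 1"
      have "(\<integral>\<^sup>+ \<omega>. 1 - Y 0 \<omega> \<partial>M) = (\<integral>\<^sup>+ \<omega>. 1 \<partial>M) - (\<integral>\<^sup>+ \<omega>. Y 0 \<omega> \<partial>M)"
        using Y_less[of 0] \<open>c = 1\<close>
        by (intro nn_integral_diff) (auto simp: EY intro: less_imp_le)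
      then have "(\<integral>\<^sup>+ \<omega>. 1 - Y 0 \<omega> \<partial>M) = 0"
        using \<open>c = 1\<close> by (simp add: EY emeasure_space_1)
      then have "AE \<omega> in M. 1 - Y 0 \<omega> = 0"
        by (subst (asm) nn_integral_0_iff_AE) auto
      with Y_less[of 0] have "AE \<omega> in M. False"
        by eventually_elim (auto simp: diff_eq_0_iff_ennreal)
      then show False by simp
    qed
    ultimately show ?thesis by simp
  qed
  then obtain r where r: "c = ennreal r" "0 \<le> r" "r < 1"
    by (cases c) auto
  have "(\<integral>\<^sup>+ \<omega>. (\<Sum>N. \<Prod>j<N. Y j \<omega>) \<partial>M) = (\<Sum>N. \<integral>\<^sup>+ \<omega>. (\<Prod>j<N. Y j \<omega>) \<partial>M)"
    by (rule nn_integral_suminf) measurable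
  also have "\<dots> = (\<Sum>N. c ^ N)"
  proof (intro suminf_cong)
    fix N
    have "indep_vars (\<lambda>_. borel) Y {..<N}"
      unfolding Y_def by (rule indep_vars_compose2[OF indep_vars_subset[OF indep]]) auto
    then show "(\<integral>\<^sup>+ \<omega>. (\<Prod>j<N. Y j \<omega>) \<partial>M) = c ^ N"
      by (subst indep_vars_nn_integral) (auto simp: EY)
  qed
  also have "\<dots> = ennreal (1 / (1 - r))"
    unfolding r(1) ennreal_power[OF r(2)]
    using r(2,3) by (intro suminf_ennreal_eq geometric_sums) auto
  finally have "(\<integral>\<^sup>+ \<omega>. (\<Sum>N. \<Prod>j<N. Y j \<omega>) \<partial>M) \<noteq> \<infinity>"
    by simp
  then have "AE \<omega> in M. (\<Sum>N. \<Prod>j<N. Y j \<omega>) \<noteq> \<infinity>"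
    by (intro nn_integral_noteq_infinite) measurable
  moreover have "AE \<omega> in M. \<forall>n. 0 < X n \<omega> \<and> X n \<omega> < 1"
    using unit by (simp add: AE_all_countable)
  ultimately show ?thesis
  proof eventually_elim
    case (elim \<omega>)
    have "(\<Prod>j<N. Y j \<omega>) = ennreal (\<Prod>j<N. 1 - X j \<omega>)" for N
      unfolding Y_def using elim(2) by (intro prod_ennreal) (simp add: less_imp_le)
    then have "summable (\<lambda>N. \<Prod>j<N. 1 - X j \<omega>)"
      using elim by (intro summable_suminf_not_top) (auto intro!: prod_nonneg simp: less_imp_le)
    then show ?case
      by (rule summable_LIMSEQ_zero)
  qed
qed

theorem theorem1:
  fixes M :: "'w measure"
    and P0 :: "'a::polish_space measure"
    and \<theta> a b :: real
    and vs :: "nat \<Rightarrow> 'w \<Rightarrow> real"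
    and v :: "'w \<Rightarrow> real"
    and z :: "nat \<Rightarrow> 'w \<Rightarrow> 'a"
    and w w' :: "nat \<Rightarrow> 'w \<Rightarrow> real"
    and P P' :: "'w \<Rightarrow> 'a measure"
  assumes "\<theta> > 0" and "a > 0" and "b > 0"
    and "prob_space M"
    and "prob_space.indep_vars M (\<lambda>_. borel) vs UNIV"
    and "\<And>n. distributed M lborel (vs n) (beta_density 1 \<theta>)"
    and "distributed M lborel v (beta_density a b)"
    and "prob_space P0" and "sets P0 = sets borel" and "non_atomic P0"
    and "prob_space.indep_vars M (\<lambda>_. borel) z UNIV"
    and "\<And>n. distr M borel (z n) = P0"
    and w_def: "w = (\<lambda>n \<omega>. stick_weight (\<lambda>j. vs j \<omega>) n)"
    and w'_def: "w' = (\<lambda>n \<omega>. geom_weight (v \<omega>) n)"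
    and "indep_rvs M
           (PiM UNIV (\<lambda>_. borel)) (\<lambda>\<omega> n. z n \<omega>)
           (PiM UNIV (\<lambda>_. borel \<Otimes>\<^sub>M borel)) (\<lambda>\<omega> n. (w n \<omega>, w' n \<omega>))"
    and P_def: "P = (\<lambda>\<omega>. discrete_measure (\<lambda>n. w n \<omega>) (\<lambda>n. z n \<omega>))"
    and P'_def: "P' = (\<lambda>\<omega>. discrete_measure (\<lambda>n. w' n \<omega>) (\<lambda>n. z n \<omega>))"
  shows "(AE \<omega> in M.
            (\<lambda>n. ereal (w n \<omega> * ln (w n \<omega> / w' n \<omega>))) sums D_KL (P \<omega>) (P' \<omega>) \<and>
            (\<lambda>n. ereal ((\<Prod>j<n. 1 - vs j \<omega>) * binary_div (vs n \<omega>) (v \<omega>)))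
              sums D_KL (P \<omega>) (P' \<omega>)) \<and>
         (AE \<omega> in M.
            (\<lambda>n. ereal (w' n \<omega> * ln (w' n \<omega> / w n \<omega>))) sums D_KL (P' \<omega>) (P \<omega>) \<and>
            (\<lambda>n. ereal ((1 - v \<omega>) ^ n * binary_div (v \<omega>) (vs n \<omega>)))
              sums D_KL (P' \<omega>) (P \<omega>))"
proof -
  interpret prob_space M by fact
  note indep_vs = assms(5) and beta_vs = assms(6) and beta_v = assms(7)
  have distr_vs: "distr M borel (vs n) = density lborel (\<lambda>x. ennreal (beta_density 1 \<theta> x))" for n
    using distributed_distr_eq_density[OF beta_vs[of n]]
    by (simp cong: distr_cong)
  have unit_vs: "AE \<omega> in M. 0 < vs n \<omega> \<and> vs n \<omega> < 1" for n
    by (rule beta_AE_in_unit_interval[OF beta_vs])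
  have "AE \<omega> in M. \<forall>n. 0 < vs n \<omega> \<and> vs n \<omega> < 1"
    using unit_vs by (simp add: AE_all_countable)
  moreover have "AE \<omega> in M. 0 < v \<omega> \<and> v \<omega> < 1"
    by (rule beta_AE_in_unit_interval[OF beta_v])
  moreover have "AE \<omega> in M. (\<lambda>N. \<Prod>j<N. 1 - vs j \<omega>) \<longlonglongrightarrow> 0"
    by (rule AE_prod_one_minus_tendsto_0[OF indep_vs distr_vs unit_vs])
  moreover have "AE \<omega> in M. inj (\<lambda>n. z n \<omega>)"
    using assms(10-12) by (intro AE_inj_non_atomic)
  ultimately have "AE \<omega> in M.
      ((\<lambda>n. ereal (w n \<omega> * ln (w n \<omega> / w' n \<omega>))) sums D_KL (P \<omega>) (P' \<omega>) \<and>
       (\<lambda>n. ereal ((\<Prod>j<n. 1 - vs j \<omega>) * binary_div (vs n \<omega>) (v \<omega>))) sums D_KL (P \<omega>) (P' \<omega>)) \<and>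
      ((\<lambda>n. ereal (w' n \<omega> * ln (w' n \<omega> / w n \<omega>))) sums D_KL (P' \<omega>) (P \<omega>) \<and>
       (\<lambda>n. ereal ((1 - v \<omega>) ^ n * binary_div (v \<omega>) (vs n \<omega>))) sums D_KL (P' \<omega>) (P \<omega>))"
  proof eventually_elim
    case (elim \<omega>)
    define x where "x j = vs j \<omega>" for j
    define y :: "nat \<Rightarrow> real" where "y = (\<lambda>_. v \<omega>)"
    have x: "0 < x n" "x n < 1" and y: "0 < y n" "y n < 1" for n
      using elim by (auto simp: x_def y_def)
    have Sx: "(\<lambda>N. \<Prod>j<N. 1 - x j) \<longlonglongrightarrow> 0"
      using elim by (simp add: x_def)
    have Sy: "(\<lambda>N. \<Prod>j<N. 1 - y j) \<longlonglongrightarrow> 0"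
      using elim by (auto simp: y_def intro!: LIMSEQ_power_zero)
    have w: "w n \<omega> = stick_weight x n" "w' n \<omega> = stick_weight y n" for n
      by (simp_all add: w_def w'_def x_def[abs_def] y_def stick_weight_const)
    have P: "P \<omega> = discrete_measure (stick_weight x) (\<lambda>n. z n \<omega>)"
        "P' \<omega> = discrete_measure (stick_weight y) (\<lambda>n. z n \<omega>)"
      by (simp_all add: P_def P'_def w)
    show ?case
      using D_KL_stick_breaking[of x y, OF x y Sx Sy elim(4)]
        D_KL_stick_breaking[of y x, OF y x Sy Sx elim(4)]
      unfolding w P by (simp add: x_def y_def)
  qed
  then show ?thesis
    by (auto elim: eventually_mono)
qed

end
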